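(* For each integral ideal $\mathfrak a\in\mathcal I_{\mathfrak m}$, let $$\mathcal F_{\mathfrak a}:=\{\chi\in\widehat{\mathfrak a}:u\chi=\chi\text{ for all }u\in R_{\mathfrak m,\Gamma}^*\}.$$ If $R_{\mathfrak m,\Gamma}^*\ne\{1\}$, then $\mathcal F_R$ is finite and $|\mathcal F_{\mathfrak a}|=|\mathcal F_R|$ for every integral ideal $\mathfrak a\in\mathcal I_{\mathfrak m}$.
   Context: $K$ is a number field with ring of integers $R$, $R^*$ its unit group. A modulus $\mathfrak m=\mathfrak m_\infty\mathfrak m_0$ consists of a $\{0,1\}$-valued function $\mathfrak m_\infty$ on the real embeddings of $K$ and a nonzero ideal $\mathfrak m_0$ of $R$; $w\mid\mathfrak m_\infty$ means $\mathfrak m_\infty(w)=1$. $(R/\mathfrak m)^*:=\big(\prod_{w\mid\mathfrak m_\infty}\{\pm1\}\big)\times(R/\mathfrak m_0)^*$ and, for $a\in R$ nonzero and coprime to $\mathfrak m_0$, $[a]_{\mathfrak m}:=((\operatorname{sign}w(a))_{w\mid\mathfrak m_\infty},a+\mathfrak m_0)$. $\Gamma$ is a subgroup of $(R/\mathfrak m)^*$, and $R_{\mathfrak m,\Gamma}^*:=\{u\in R^*:[u]_{\mathfrak m}\in\Gamma\}$ (the unit group of the congruence monoid $R_{\mathfrak m,\Gamma}$ of nonzero $a\in R$ coprime to $\mathfrak m_0$ with $[a]_{\mathfrak m}\in\Gamma$). $\mathcal I_{\mathfrak m}$ is the group of fractional ideals of $K$ coprime to $\mathfrak m_0$; integral ideals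 are those contained in $R$. $\widehat{\mathfrak a}$ is the Pontryagin dual of the additive group $\mathfrak a$, and $R_{\mathfrak m,\Gamma}^*$ acts on it by duality from the multiplication action on $\mathfrak a$, i.e. $(u\chi)(x)=\chi(u^{-1}x)$. *)

theory Defs
  imports
    Complex_Main
    "HOL-Algebra.Algebra"
    "HOL-Algebra.Algebraic_Closure_Type"
    "HOL-Algebra.Ideal_Product"
    "HOL-Algebra.Product_Groups"
    "HOL-Library.Equipollence"
begin

text \<open>A number field is a type of class \<open>field_char_0\<close> that is finite-dimensional as a
  vector space over the rationals.\<close>

definition number_field :: "'k::field_char_0 itself \<Rightarrow> bool"
  where "number_field _ \<longleftrightarrow>
    (\<exists>B. finite_dimensional_vector_space (\<lambda>(q::rat) (x::'k). of_rat q * x) B)"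

lemma number_field_rat: "number_field TYPE(rat)"
proof -
  interpret vector_space "\<lambda>(q::rat) (x::rat). of_rat q * x"
    by unfold_locales (simp_all add: algebra_simps of_rat_add of_rat_mult)
  have "span {1} = (UNIV :: rat set)"
    unfolding span_singleton by (auto simp: image_iff)
  moreover have "independent {1::rat}"
    unfolding dependent_single by simp
  ultimately have "finite_dimensional_vector_space (\<lambda>(q::rat) (x::rat). of_rat q * x) {1}"
    by unfold_locales simp_all
  then show ?thesis
    unfolding number_field_def ..
qed

text \<open>The field \<open>K\<close> and its ring of integers \<open>R\<close> as \<open>HOL-Algebra\<close> rings. The ideals of \<open>R\<close>
  and the fractional ideals are subsets of the type \<open>'k\<close>.\<close>

abbreviation number_field_ring :: "'k::field_char_0 ring" (\<open>\<K>\<close>)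
  where "\<K> \<equiv> ring_of_type_algebra"

definition ring_of_integers :: "'k::field_char_0 ring" (\<open>\<O>\<close>)
  where "\<O> = \<K>\<lparr>carrier := {x. algebraic_int x}\<rparr>"

definition real_embeddings :: "('k::field_char_0 \<Rightarrow> real) set"
  where "real_embeddings = ring_hom \<K> ring_of_type_algebra"

definition is_modulus :: "(('k::field_char_0 \<Rightarrow> real) \<Rightarrow> nat) \<Rightarrow> 'k set \<Rightarrow> bool"
  where "is_modulus m_inf m0 \<longleftrightarrow>
    m_inf \<in> real_embeddings \<rightarrow> {0, 1} \<and> ideal m0 \<O> \<and> m0 \<noteq> {0}"

text \<open>The real embeddings \<open>w\<close> with \<open>w | m_inf\<close>. The values of \<open>m_inf\<close> at functions that are not
  real embeddings play no role.\<close>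

definition infinite_part :: "(('k::field_char_0 \<Rightarrow> real) \<Rightarrow> nat) \<Rightarrow> ('k \<Rightarrow> real) set"
  where "infinite_part m_inf = {w \<in> real_embeddings. m_inf w = 1}"

text \<open>The group \<open>(R/m)\<^sup>*\<close>; \<open>sign_img\<close> is the multiplicative group \<open>{-1, 1}\<close> of integers.\<close>

definition modulus_units ::
    "(('k::field_char_0 \<Rightarrow> real) \<Rightarrow> nat) \<Rightarrow> 'k set \<Rightarrow> ((('k \<Rightarrow> real) \<Rightarrow> int) \<times> 'k set) monoid"
  where "modulus_units m_inf m0 =
    product_group (infinite_part m_inf) (\<lambda>_. sign_img) \<times>\<times> units_of (\<O> Quot m0)"

text \<open>The class \<open>[a]\<^sub>m\<close>, meaningful for nonzero \<open>a\<close> in \<open>R\<close> coprime to \<open>m0\<close>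
  (so that \<open>w a \<noteq> 0\<close>), in particular for units of \<open>R\<close>.\<close>

definition modulus_class ::
    "(('k::field_char_0 \<Rightarrow> real) \<Rightarrow> nat) \<Rightarrow> 'k set \<Rightarrow> 'k \<Rightarrow> (('k \<Rightarrow> real) \<Rightarrow> int) \<times> 'k set"
  where "modulus_class m_inf m0 a =
    ((\<lambda>w\<in>infinite_part m_inf. if w a > 0 then 1 else -1), m0 +>\<^bsub>\<O>\<^esub> a)"

definition congruence_units ::
    "(('k::field_char_0 \<Rightarrow> real) \<Rightarrow> nat) \<Rightarrow> 'k set \<Rightarrow> ((('k \<Rightarrow> real) \<Rightarrow> int) \<times> 'k set) set \<Rightarrow> 'k set"
  where "congruence_units m_inf m0 \<Gamma> = {u \<in> Units \<O>. modulus_class m_inf m0 u \<in> \<Gamma>}"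

definition fractional_ideal :: "'k::field_char_0 set \<Rightarrow> bool"
  where "fractional_ideal J \<longleftrightarrow>
    additive_subgroup J \<K> \<and> J \<noteq> {0} \<and>
    (\<forall>r\<in>carrier \<O>. \<forall>x\<in>J. r * x \<in> J) \<and>
    (\<exists>d\<in>carrier \<O>. d \<noteq> 0 \<and> (\<forall>x\<in>J. d * x \<in> carrier \<O>))"

definition integral_coprime :: "'k::field_char_0 set \<Rightarrow> 'k set \<Rightarrow> bool"
  where "integral_coprime m0 I \<longleftrightarrow> ideal I \<O> \<and> I \<noteq> {0} \<and> I <+>\<^bsub>\<O>\<^esub> m0 = carrier \<O>"

text \<open>A fractional ideal is coprime to \<open>m0\<close> iff it is a quotient \<open>B / C\<close> of nonzero ideals
  of \<open>R\<close> coprime to \<open>m0\<close>, i.e. no prime dividing \<open>m0\<close> occurs in its factorization.\<close>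

definition coprime_fractional_ideals :: "'k::field_char_0 set \<Rightarrow> 'k set set"
  where "coprime_fractional_ideals m0 =
    {J. fractional_ideal J \<and>
      (\<exists>B C. integral_coprime m0 B \<and> integral_coprime m0 C \<and> ideal_prod \<K> J C = B)}"

definition circle_group :: "complex monoid"
  where "circle_group = \<lparr>carrier = {z. cmod z = 1}, monoid.mult = (*), one = 1\<rparr>"

text \<open>Ideals carry the discrete topology, so every character is continuous. Characters are
  \<open>undefined\<close> outside \<open>A\<close>, so that they are determined by their values on \<open>A\<close>.\<close>

definition pontryagin_dual :: "'k::field_char_0 set \<Rightarrow> ('k \<Rightarrow> complex) set"
  where "pontryagin_dual A = hom (add_monoid (\<K>\<lparr>carrier := A\<rparr>)) circle_group \<inter> extensional A"

definition dual_action :: "'k::field_char_0 set \<Rightarrow> 'k \<Rightarrow> ('k \<Rightarrow> complex) \<Rightarrow> 'k \<Rightarrow> complex"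
  where "dual_action A u \<chi> = (\<lambda>x\<in>A. \<chi> (inverse u * x))"

definition fixed_characters ::
    "(('k::field_char_0 \<Rightarrow> real) \<Rightarrow> nat) \<Rightarrow> 'k set \<Rightarrow> ((('k \<Rightarrow> real) \<Rightarrow> int) \<times> 'k set) set \<Rightarrow>
      'k set \<Rightarrow> ('k \<Rightarrow> complex) set"
  where "fixed_characters m_inf m0 \<Gamma> A =
    {\<chi> \<in> pontryagin_dual A. \<forall>u\<in>congruence_units m_inf m0 \<Gamma>. dual_action A u \<chi> = \<chi>}"

end

theory Submission
  imports Defs "Jordan_Normal_Form.Char_Poly"
begin

text \<open>A character of \<open>\<aa>\<close> is fixed by all units \<open>u\<close> of the congruence subgroup iff it is trivial on
  \<open>J\<aa>\<close>, where \<open>J\<close> is the ideal of \<open>\<O>\<close> generated by the elements \<open>u\<inverse> - 1\<close>. So the fixed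
  characters form the dual of \<open>\<aa>/J\<aa>\<close>. As soon as some \<open>u \<noteq> 1\<close> exists, \<open>J\<close> is nonzero, so
  \<open>\<O>/J\<close> is finite, and the claim follows from the fact that over a Dedekind domain
  \<open>\<aa>/J\<aa>\<close> and \<open>\<O>/J\<close> are isomorphic.

  This isomorphism is made explicit (\<open>integral_ideal_generator_modulo\<close>): there are
  \<open>\<alpha> \<in> \<aa>\<close> and \<open>\<beta> \<in> \<aa>\<inverse>\<close> with \<open>\<alpha>\<beta> \<equiv> 1\<close> modulo \<open>J\<close>. Multiplication by \<open>\<alpha>\<close> maps \<open>\<O>\<close> to
  \<open>\<aa>\<close>, multiplication by \<open>\<beta>\<close> maps \<open>\<aa>\<close> to \<open>\<O>\<close>, and pulling fixed characters back along
  these two maps gives mutually inverse bijections.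

  The element \<open>\<alpha>\<close> is found by an argument of Chinese remainder type: \<open>\<alpha>\<aa>\<inverse> + J\<close> is an ideal, which
  is all of \<open>\<O>\<close> iff no maximal ideal \<open>P \<supseteq> J\<close> contains it. There are finitely many such \<open>P\<close>, and for
  each of them some \<open>\<alpha>\<close> works because \<open>\<aa>\<close> is invertible at \<open>P\<close>
  (\<open>integral_ideal_locally_invertible\<close>). The proof of the latter is the classical one for
  Dedekind domains: there is \<open>\<gamma> \<notin> \<O>\<close> with \<open>\<gamma>P \<subseteq> \<O>\<close>, and if \<open>\<aa>\<aa>\<inverse> \<subseteq> P\<close>, then \<open>\<gamma>\<aa>\<inverse> \<subseteq> \<aa>\<inverse>\<close>, which
  would force \<open>\<gamma>\<close> to be integral.

  All finiteness statements rest on one fact: \<open>\<O>/n\<O>\<close> is finite for every \<open>n > 0\<close>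
  (\<open>finite_residues\<close>). For a prime \<open>p\<close> this holds because elements of \<open>\<O>\<close> that are independent
  modulo \<open>p\<close> are linearly independent over the rationals, so \<open>\<O>/p\<O>\<close> has dimension at most the degree of
  \<open>K\<close>.\<close>

section \<open>The ring of algebraic integers\<close>

interpretation int_span: Modules.module "\<lambda>(c::int) (x::'k::field_char_0). of_int c * x"
  by unfold_locales (simp_all add: algebra_simps)

text \<open>With \<open>of_int_mult\<close> this simplification rule rewrites in a circle.\<close>

declare int_span.scale_scale [simp del]

text \<open>If multiplication by \<open>z\<close> maps the additive group generated by \<open>B\<close> into itself, then its
  matrix with respect to \<open>B\<close> is an integer matrix with eigenvalue \<open>z\<close>, the eigenvector being \<open>B\<close>
  itself. So \<open>z\<close> is a root of the characteristic polynomial, which is monic with integer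
  coefficients.\<close>

lemma algebraic_int_if_stabilizes_int_span:
  fixes z :: "'k::field_char_0"
  assumes "finite B" "b \<in> B" "b \<noteq> 0"
    and B: "\<And>b. b \<in> B \<Longrightarrow> z * b \<in> int_span.span B"
  shows "algebraic_int z"
proof -
  define n where "n = card B"
  obtain f where f: "bij_betw f {0..<n} B"
    using ex_bij_betw_nat_finite[OF \<open>finite B\<close>] by (auto simp: n_def)
  have "\<forall>i<n. \<exists>c. z * f i = (\<Sum>b\<in>B. of_int (c b) * b)"
    using B bij_betw_apply[OF f] by (fastforce simp: int_span.span_finite[OF \<open>finite B\<close>])
  then obtain c where c: "\<And>i. i < n \<Longrightarrow> z * f i = (\<Sum>b\<in>B. of_int (c i b) * b)"
    by metis
  have c': "z * f i = (\<Sum>j=0..<n. of_int (c i (f j)) * f j)" if "i < n" for i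
    unfolding c[OF that] by (rule sum.reindex_bij_betw[OF f, symmetric])
  define M where "M = mat n n (\<lambda>(i, j). c i (f j))"
  define N where "N = map_mat (of_int :: int \<Rightarrow> 'k) M"
  define v where "v = vec n f"
  have M: "M \<in> carrier_mat n n" and N: "N \<in> carrier_mat n n"
    by (auto simp: M_def N_def)
  have "N *\<^sub>v v = z \<cdot>\<^sub>v v"
    by (rule eq_vecI) (auto simp: N_def M_def v_def scalar_prod_def c')
  moreover have "v \<noteq> 0\<^sub>v n"
  proof -
    obtain i where "i < n" "f i = b"
      using bij_betw_imp_surj_on[OF f] \<open>b \<in> B\<close> by (metis atLeastLessThan_iff imageE)
    then have "v $ i \<noteq> 0\<^sub>v n $ i"
      using \<open>b \<noteq> 0\<close> by (simp add: v_def)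
    then show ?thesis by metis
  qed
  ultimately have "eigenvalue N z"
    using N unfolding eigenvalue_def eigenvector_def by (intro exI[of _ v]) (auto simp: v_def)
  then have "poly (char_poly N) z = 0"
    using eigenvalue_root_char_poly[OF N] by simp
  moreover have "char_poly N = map_poly of_int (char_poly M)"
    unfolding N_def by (rule of_int_hom.char_poly_hom[OF M])
  moreover have "lead_coeff (char_poly M) = 1"
    using degree_monic_char_poly[OF M] by simp
  ultimately show ?thesis
    unfolding algebraic_int_altdef_ipoly by auto
qed

lemma algebraic_int_power_in_span:
  fixes x :: "'k::field_char_0"
  assumes "algebraic_int x"
  obtains n where "n > 0" "x ^ n \<in> int_span.span ((\<lambda>i. x ^ i) ` {..<n})"
proof -
  obtain p :: "int poly" where p: "poly (map_poly of_int p) x = 0" "lead_coeff p = 1"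
    using assms unfolding algebraic_int_altdef_ipoly by auto
  define n where "n = Polynomial.degree p"
  have deg: "Polynomial.degree (map_poly (of_int :: int \<Rightarrow> 'k) p) = n"
    by (simp add: n_def degree_map_poly)
  have "0 = (\<Sum>i\<le>n. of_int (Polynomial.coeff p i) * x ^ i)"
    using p(1) by (simp add: poly_altdef deg coeff_map_poly n_def)
  also have "\<dots> = (\<Sum>i<n. of_int (Polynomial.coeff p i) * x ^ i) + x ^ n"
    using p(2) by (simp add: lessThan_Suc_atMost[symmetric] n_def)
  finally have eq: "x ^ n = (\<Sum>i<n. of_int (- Polynomial.coeff p i) * x ^ i)"
    by (simp add: sum_negf eq_neg_iff_add_eq_0 add.commute)
  show ?thesis
  proof
    show "n > 0"
    proof (rule ccontr)
      assume "\<not> n > 0"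
      then show False using eq by simp
    qed
    show "x ^ n \<in> int_span.span ((\<lambda>i. x ^ i) ` {..<n})"
      unfolding eq by (intro int_span.span_sum int_span.span_scale int_span.span_base) auto
  qed
qed

lemma mult_mem_int_span:
  fixes z :: "'k::field_char_0"
  assumes "\<And>b. b \<in> B \<Longrightarrow> z * b \<in> int_span.span C" "w \<in> int_span.span B"
  shows "z * w \<in> int_span.span C"
  using assms(2)
proof (induction rule: int_span.span_induct_alt)
  case base
  then show ?case by (simp add: int_span.span_zero)
next
  case (step c b w)
  have "z * (of_int c * b + w) = of_int c * (z * b) + z * w" by (simp add: algebra_simps)
  then show ?case
    using step assms(1) by (simp add: int_span.span_add int_span.span_scale)
qed

text \<open>The products \<open>x\<^sup>i y\<^sup>j\<close> with exponents below the degrees of integral equations of \<open>x\<close> and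
  \<open>y\<close> generate a group that is stable under \<open>x\<close> and \<open>y\<close>, hence under \<open>x + y\<close> and \<open>x * y\<close>.\<close>

lemma algebraic_int_common_span:
  fixes x y :: "'k::field_char_0"
  assumes "algebraic_int x" "algebraic_int y"
  obtains B where "finite B" "1 \<in> B"
    "\<And>b. b \<in> B \<Longrightarrow> x * b \<in> int_span.span B" "\<And>b. b \<in> B \<Longrightarrow> y * b \<in> int_span.span B"
proof -
  obtain m where m: "m > 0" "x ^ m \<in> int_span.span ((\<lambda>i. x ^ i) ` {..<m})"
    by (rule algebraic_int_power_in_span[OF assms(1)])
  obtain n where n: "n > 0" "y ^ n \<in> int_span.span ((\<lambda>i. y ^ i) ` {..<n})"
    by (rule algebraic_int_power_in_span[OF assms(2)])
  define B where "B = (\<lambda>(i, j). x ^ i * y ^ j) ` ({..<m} \<times> {..<n})"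
  have base: "x ^ i * y ^ j \<in> int_span.span B" if "i < m" "j < n" for i j
    by (intro int_span.span_base) (use that in \<open>force simp: B_def\<close>)
  show ?thesis
  proof
    show "finite B" by (simp add: B_def)
    show "1 \<in> B" using m(1) n(1) by (force simp: B_def intro: image_eqI[where x = "(0, 0)"])
    fix b assume "b \<in> B"
    then obtain i j where b: "b = x ^ i * y ^ j" and ij: "i < m" "j < n" by (auto simp: B_def)
    have "y ^ j * x ^ m \<in> int_span.span B"
      by (rule mult_mem_int_span[OF _ m(2)]) (use ij base in \<open>auto simp: mult.commute\<close>)
    then show "x * b \<in> int_span.span B"
      using base[of "Suc i" j] ij by (cases "Suc i = m") (auto simp: b algebra_simps)
    have "x ^ i * y ^ n \<in> int_span.span B"
      by (rule mult_mem_int_span[OF _ n(2)]) (use ij base in auto)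
    then show "y * b \<in> int_span.span B"
      using base[of i "Suc j"] ij by (cases "Suc j = n") (auto simp: b algebra_simps)
  qed
qed

lemma algebraic_int_add:
  fixes x y :: "'k::field_char_0"
  assumes "algebraic_int x" "algebraic_int y"
  shows "algebraic_int (x + y)"
proof -
  obtain B where B: "finite B" "1 \<in> B"
    "\<And>b. b \<in> B \<Longrightarrow> x * b \<in> int_span.span B" "\<And>b. b \<in> B \<Longrightarrow> y * b \<in> int_span.span B"
    by (rule algebraic_int_common_span[OF assms]) blast
  show ?thesis
    by (rule algebraic_int_if_stabilizes_int_span[OF B(1,2)])
       (auto simp: distrib_right intro: int_span.span_add B)
qed

lemma algebraic_int_mult:
  fixes x y :: "'k::field_char_0"
  assumes "algebraic_int x" "algebraic_int y"
  shows "algebraic_int (x * y)"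
proof -
  obtain B where B: "finite B" "1 \<in> B"
    "\<And>b. b \<in> B \<Longrightarrow> x * b \<in> int_span.span B" "\<And>b. b \<in> B \<Longrightarrow> y * b \<in> int_span.span B"
    by (rule algebraic_int_common_span[OF assms]) blast
  show ?thesis
    by (rule algebraic_int_if_stabilizes_int_span[OF B(1,2)])
       (auto simp: mult.assoc intro: mult_mem_int_span[OF B(3)] B(4))
qed

lemma algebraic_int_diff:
  fixes x y :: "'k::field_char_0"
  assumes "algebraic_int x" "algebraic_int y"
  shows "algebraic_int (x - y)"
  using algebraic_int_add[OF assms(1) algebraic_int_minus[OF assms(2)]] by simp

lemma algebraic_int_power:
  fixes x :: "'k::field_char_0"
  assumes "algebraic_int x"
  shows "algebraic_int (x ^ n)"
  by (induction n) (auto intro: algebraic_int_mult assms)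

lemma algebraic_int_sum:
  fixes f :: "'a \<Rightarrow> 'k::field_char_0"
  assumes "\<And>i. i \<in> S \<Longrightarrow> algebraic_int (f i)"
  shows "algebraic_int (sum f S)"
  using assms by (induction S rule: infinite_finite_induct) (auto intro: algebraic_int_add)

section \<open>Finiteness of residue rings\<close>

text \<open>Linear independence of the residue classes of \<open>S\<close> in \<open>\<O>/p\<O>\<close> over the field with \<open>p\<close>
  elements, for a prime \<open>p\<close>.\<close>

definition residue_independent :: "int \<Rightarrow> 'k::field_char_0 set \<Rightarrow> bool"
  where "residue_independent p S \<longleftrightarrow> finite S \<and> (\<forall>s\<in>S. algebraic_int s) \<and>
    (\<forall>c y. algebraic_int y \<longrightarrow> (\<Sum>s\<in>S. of_int (c s) * s) = of_int p * y \<longrightarrow> (\<forall>s\<in>S. p dvd c s))"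

lemma residue_independentD:
  assumes "residue_independent p S" "algebraic_int y" "(\<Sum>s\<in>S. of_int (c s) * s) = of_int p * y"
  shows "\<forall>s\<in>S. p dvd c s"
  using assms unfolding residue_independent_def by simp

lemma common_denominator:
  fixes u :: "'a \<Rightarrow> rat"
  assumes "finite S"
  obtains N :: int and c :: "'a \<Rightarrow> int"
  where "N \<noteq> 0" "\<And>s. s \<in> S \<Longrightarrow> of_int N * u s = of_int (c s)"
proof -
  have "\<exists>N::int. N \<noteq> 0 \<and> (\<forall>s\<in>S. of_int N * u s \<in> \<int>)"
    using assms
  proof (induction S rule: finite_induct)
    case empty
    then show ?case by (intro exI[of _ 1]) auto
  next
    case (insert s S)
    then obtain N :: int where N: "N \<noteq> 0" "\<forall>s\<in>S. of_int N * u s \<in> \<int>" by blast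
    obtain a b where ab: "quotient_of (u s) = (a, b)"
      by (cases "quotient_of (u s)")
    have b: "b > 0" "u s = of_int a / of_int b"
      using quotient_of_denom_pos[OF ab] quotient_of_div[OF ab] .
    have "of_int (N * b) * u s = of_int (N * a)"
      using b by simp
    then have "of_int (N * b) * u s \<in> \<int>"
      by (simp only: Ints_of_int)
    moreover have "of_int (N * b) * u t \<in> \<int>" if "t \<in> S" for t
    proof -
      have "of_int (N * b) * u t = of_int b * (of_int N * u t)"
        by simp
      also have "\<dots> \<in> \<int>"
        by (rule Ints_mult[OF Ints_of_int]) (use N(2) that in blast)
      finally show ?thesis .
    qed
    ultimately show ?case
      using N(1) b(1) by (intro exI[of _ "N * b"]) auto
  qed
  then obtain N :: int where N: "N \<noteq> 0" "\<forall>s\<in>S. of_int N * u s \<in> \<int>" by blast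
  then have "\<exists>k. of_int N * u s = of_int k" if "s \<in> S" for s
    using that by (auto elim: Ints_cases)
  then obtain c where "\<And>s. s \<in> S \<Longrightarrow> of_int N * u s = of_int (c s)"
    by metis
  then show ?thesis
    by (rule that[OF N(1)])
qed

text \<open>A nontrivial rational relation between elements of \<open>\<O>\<close> can be scaled to an integral one
  whose coefficients have no common divisor, and this is a nontrivial relation modulo \<open>p\<close>. So
  independence modulo \<open>p\<close> implies independence over the rationals.\<close>

lemma residue_independent_card_bounded:
  assumes K: "number_field TYPE('k::field_char_0)" and p: "Factorial_Ring.prime p"
  obtains d where "\<And>S :: 'k set. residue_independent p S \<Longrightarrow> card S \<le> d"
proof -
  obtain B where "finite_dimensional_vector_space (\<lambda>(q::rat) (x::'k). of_rat q * x) B"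
    using K unfolding number_field_def by blast
  then interpret Q: finite_dimensional_vector_space "\<lambda>(q::rat) (x::'k). of_rat q * x" B .
  note Q.scale_scale [simp del]
  have "card S \<le> Q.dim UNIV" if S: "residue_independent p S" for S :: "'k set"
  proof (rule Q.independent_card_le_dim)
    have fin: "finite S"
      using S by (simp add: residue_independent_def)
    show "Q.independent S"
    proof
      assume "Q.dependent S"
      then obtain u where u: "\<exists>s\<in>S. u s \<noteq> 0" "(\<Sum>s\<in>S. of_rat (u s) * s) = 0"
        unfolding Q.dependent_finite[OF fin] by blast
      obtain N c where N: "N \<noteq> 0" "\<And>s. s \<in> S \<Longrightarrow> of_int N * u s = of_int (c s)"
        using common_denominator[OF fin, of u] by blast
      \<comment> \<open>The content of the relation, which is divided out.\<close>
      define g where "g = Gcd (c ` S)"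
      have "\<exists>s\<in>S. c s \<noteq> 0"
      proof -
        obtain s where s: "s \<in> S" "u s \<noteq> 0"
          using u(1) by blast
        then show ?thesis
          using N(1) N(2)[OF s(1)] by (intro bexI[of _ s]) auto
      qed
      then have g: "g \<noteq> 0"
        by (auto simp: g_def)
      have "of_int (c s) = of_int N * (of_rat (u s) :: 'k)" if "s \<in> S" for s
        using arg_cong[OF N(2)[OF that], of "of_rat :: rat \<Rightarrow> 'k"] by (simp add: of_rat_mult)
      then have "(\<Sum>s\<in>S. of_int (c s) * s) = of_int N * (\<Sum>s\<in>S. of_rat (u s) * s)"
        by (simp add: sum_distrib_left mult.assoc)
      then have *: "(\<Sum>s\<in>S. of_int (c s) * s) = 0"
        using u(2) by simp
      have "\<exists>d. c s = g * d" if "s \<in> S" for s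
      proof -
        have "g dvd c s"
          using that by (simp add: g_def)
        then show ?thesis by (elim dvdE) (rule exI)
      qed
      then obtain d where d: "\<And>s. s \<in> S \<Longrightarrow> c s = g * d s"
        by metis
      have "(\<Sum>s\<in>S. of_int (c s) * s) = of_int g * (\<Sum>s\<in>S. of_int (d s) * s)"
        by (simp add: d sum_distrib_left mult.assoc)
      then have "(\<Sum>s\<in>S. of_int (d s) * s) = of_int p * 0"
        using * g by simp
      then have "\<forall>s\<in>S. p dvd d s"
        by (rule residue_independentD[OF S algebraic_int_0])
      then have "g * p dvd c s" if "s \<in> S" for s
        using d[OF that] that by (simp add: mult_dvd_mono)
      then have "g * p dvd g"
        unfolding g_def by (intro Gcd_greatest) auto
      then have "p dvd 1"
        using g dvd_mult_cancel_left[of g p 1] by simp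
      then show False
        using p not_prime_unit by blast
    qed
  qed simp
  then show ?thesis by (rule that)
qed

text \<open>A maximal independent set modulo \<open>p\<close> generates \<open>\<O>/p\<O>\<close>, so the combinations of its elements
  with coefficients in \<open>{0..<p}\<close> represent all classes.\<close>

lemma finite_residues_mod_prime:
  assumes K: "number_field TYPE('k::field_char_0)" and p: "Factorial_Ring.prime (p::int)"
  obtains F :: "'k::field_char_0 set" where "finite F" "\<And>x. x \<in> F \<Longrightarrow> algebraic_int x"
    "\<And>x. algebraic_int x \<Longrightarrow> \<exists>f\<in>F. \<exists>y. algebraic_int y \<and> x = f + of_int p * y"
proof -
  obtain d where d: "\<And>S :: 'k set. residue_independent p S \<Longrightarrow> card S \<le> d"
    using residue_independent_card_bounded[OF K p] by blast
  have "residue_independent p ({} :: 'k set)"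
    by (simp add: residue_independent_def)
  then have "\<exists>S :: 'k set. residue_independent p S \<and> (\<forall>T :: 'k set. residue_independent p T \<longrightarrow> card T \<le> card S)"
    by (rule ex_has_greatest_nat[of "residue_independent p" _ card "Suc d"])
      (simp add: d less_Suc_eq_le)
  then obtain S :: "'k set" where S: "residue_independent p S"
    and max: "\<And>T :: 'k set. residue_independent p T \<Longrightarrow> card T \<le> card S"
    by blast
  have fin: "finite S" and alg: "\<And>s. s \<in> S \<Longrightarrow> algebraic_int s"
    using S by (auto simp: residue_independent_def)
  have p0: "p > 0" using p by (simp add: prime_gt_0_int)
  define F where "F = (\<lambda>c. \<Sum>s\<in>S. of_int (c s) * s) ` (S \<rightarrow>\<^sub>E {0..<p})"
  show ?thesis
  proof
    show "finite F" unfolding F_def by (intro finite_imageI finite_PiE fin) auto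
    show "algebraic_int x" if "x \<in> F" for x
      using that by (auto simp: F_def intro!: algebraic_int_sum algebraic_int_mult intro: alg)
    fix x :: 'k assume x: "algebraic_int x"
    \<comment> \<open>Maximality of \<open>S\<close> yields a relation in which the coefficient of \<open>x\<close> is invertible modulo \<open>p\<close>.\<close>
    have "\<exists>a c y. \<not> p dvd a \<and> algebraic_int y \<and>
        of_int a * x = (\<Sum>s\<in>S. of_int (c s) * s) + of_int p * y"
    proof (cases "x \<in> S")
      case True
      have "(\<Sum>s\<in>S. of_int (if s = x then 1 else 0) * s) = (\<Sum>s\<in>S. if s = x then s else 0)"
        by (rule sum.cong) auto
      also have "\<dots> = x"
        using True fin by simp
      finally have "x = (\<Sum>s\<in>S. of_int (if s = x then 1 else 0) * s)" ..
      then show ?thesis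
        using p not_prime_unit
        by (intro exI[of _ 1] exI[of _ "\<lambda>s. if s = x then 1 else 0"] exI[of _ 0]) auto
    next
      case False
      have "\<not> residue_independent p (insert x S)"
        using max[of "insert x S"] False fin by auto
      then obtain c y where y: "algebraic_int y" and
        "(\<Sum>s\<in>insert x S. of_int (c s) * s) = of_int p * y" and nd: "\<exists>s\<in>insert x S. \<not> p dvd c s"
        unfolding residue_independent_def using fin alg x by (auto simp del: sum.insert)
      then have eq: "of_int (c x) * x + (\<Sum>s\<in>S. of_int (c s) * s) = of_int p * y"
        using fin False by simp
      have "\<not> p dvd c x"
      proof
        assume "p dvd c x"
        then obtain k where k: "c x = p * k" by blast
        have "(\<Sum>s\<in>S. of_int (c s) * s) = of_int p * (y - of_int k * x)"
          using eq by (simp add: k algebra_simps)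
        moreover have "algebraic_int (y - of_int k * x)"
          by (intro algebraic_int_diff algebraic_int_mult x y) simp
        ultimately have "\<forall>s\<in>S. p dvd c s"
          using residue_independentD[OF S] by blast
        then show False using nd \<open>p dvd c x\<close> by auto
      qed
      moreover have "of_int (c x) * x = (\<Sum>s\<in>S. of_int (- c s) * s) + of_int p * y"
        using eq by (simp add: sum_negf algebra_simps)
      ultimately show ?thesis using y by (intro exI[of _ "c x"] exI[of _ "\<lambda>s. - c s"] exI[of _ y]) auto
    qed
    then obtain a c y where a: "\<not> p dvd a" and y: "algebraic_int y"
      and eq: "of_int a * x = (\<Sum>s\<in>S. of_int (c s) * s) + of_int p * y" by blast
    have "coprime a p"
      using prime_imp_coprime[OF p a] by (simp add: coprime_commute)
    then obtain b t where bt: "b * a + t * p = 1"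
      using bezout_int[of a p] by (metis coprime_imp_gcd_eq_1)
    define e where "e = (\<lambda>s. if s \<in> S then (b * c s) mod p else undefined)"
    define q where "q = (\<lambda>s. (b * c s) div p)"
    have be: "b * c s = e s + p * q s" if "s \<in> S" for s
      using that by (simp add: e_def q_def)
    define z where "z = (\<Sum>s\<in>S. of_int (q s) * s) + of_int b * y + of_int t * x"
    have "x = of_int (b * a + t * p) * x" by (simp add: bt)
    also have "\<dots> = of_int b * (of_int a * x) + of_int p * (of_int t * x)"
      by (simp add: algebra_simps)
    also have "\<dots> = (\<Sum>s\<in>S. of_int (b * c s) * s) + of_int p * (of_int b * y + of_int t * x)"
      unfolding eq by (simp add: algebra_simps sum_distrib_left)
    also have "(\<Sum>s\<in>S. of_int (b * c s) * s) = (\<Sum>s\<in>S. of_int (e s + p * q s) * s)"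
      by (intro sum.cong refl) (simp only: be)
    also have "\<dots> = (\<Sum>s\<in>S. of_int (e s) * s) + of_int p * (\<Sum>s\<in>S. of_int (q s) * s)"
      by (simp add: algebra_simps sum_distrib_left sum.distrib)
    finally have "x = (\<Sum>s\<in>S. of_int (e s) * s) + of_int p * z"
      by (simp add: z_def algebra_simps)
    moreover have "algebraic_int z"
      unfolding z_def
      by (intro algebraic_int_add algebraic_int_sum algebraic_int_mult x y) (auto intro: alg)
    moreover have "e \<in> S \<rightarrow>\<^sub>E {0..<p}"
      using p0 by (auto simp: e_def PiE_def extensional_def)
    ultimately show "\<exists>f\<in>F. \<exists>y. algebraic_int y \<and> x = f + of_int p * y"
      unfolding F_def by (intro bexI[OF _ imageI] exI conjI)
  qed
qed

text \<open>Representatives modulo \<open>p * m\<close> are \<open>f + p * g\<close> with \<open>f\<close> and \<open>g\<close> running through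
  representatives modulo \<open>p\<close> and modulo \<open>m\<close>.\<close>

lemma finite_residues:
  assumes K: "number_field TYPE('k::field_char_0)" and "n > 0"
  obtains F :: "'k::field_char_0 set" where "finite F" "\<And>x. x \<in> F \<Longrightarrow> algebraic_int x"
    "\<And>x. algebraic_int x \<Longrightarrow> \<exists>f\<in>F. \<exists>y. algebraic_int y \<and> x = f + of_nat n * y"
proof -
  have "\<exists>F :: 'k set. finite F \<and> (\<forall>x\<in>F. algebraic_int x) \<and>
    (\<forall>x. algebraic_int x \<longrightarrow> (\<exists>f\<in>F. \<exists>y. algebraic_int y \<and> x = f + of_nat n * y))"
    using \<open>n > 0\<close>
  proof (induction n rule: less_induct)
    case (less n)
    show ?case
    proof (cases "n = 1")
      case True
      then show ?thesis by (intro exI[of _ "{0}"]) auto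
    next
      case False
      then obtain p where p: "Factorial_Ring.prime p" "p dvd n"
        using prime_factor_nat by blast
      then obtain m where n: "n = p * m" by blast
      have "m < n" "m > 0"
        using less.prems prime_gt_1_nat[OF p(1)] by (auto simp: n)
      then obtain G :: "'k set" where G: "finite G" "\<And>x. x \<in> G \<Longrightarrow> algebraic_int x"
        "\<And>x. algebraic_int x \<Longrightarrow> \<exists>f\<in>G. \<exists>y. algebraic_int y \<and> x = f + of_nat m * y"
        using less.IH by meson
      obtain F :: "'k set" where F: "finite F" "\<And>x. x \<in> F \<Longrightarrow> algebraic_int x"
        "\<And>x. algebraic_int x \<Longrightarrow> \<exists>f\<in>F. \<exists>y. algebraic_int y \<and> x = f + of_int (int p) * y"
        by (rule finite_residues_mod_prime[OF K, of "int p"]) (use p(1) in \<open>simp, blast\<close>)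
      show ?thesis
      proof (intro exI[of _ "(\<lambda>(f, g). f + of_nat p * g) ` (F \<times> G)"] conjI ballI allI impI)
        show "finite ((\<lambda>(f, g). f + of_nat p * g) ` (F \<times> G))"
          using F(1) G(1) by simp
        show "algebraic_int x" if "x \<in> (\<lambda>(f, g). f + of_nat p * g) ` (F \<times> G)" for x
          using that by (auto intro!: algebraic_int_add algebraic_int_mult intro: F(2) G(2))
        fix x :: 'k assume x: "algebraic_int x"
        obtain f y where f: "f \<in> F" "algebraic_int y" "x = f + of_nat p * y"
          using F(3)[OF x] by auto
        then obtain g z where g: "g \<in> G" "algebraic_int z" "y = g + of_nat m * z"
          using G(3) by blast
        have "x = (f + of_nat p * g) + of_nat n * z"
          by (simp add: f g n algebra_simps)
        then show "\<exists>f\<in>(\<lambda>(f, g). f + of_nat p * g) ` (F \<times> G). \<exists>y. algebraic_int y \<and> x = f + of_nat n * y"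
          using f g by (intro bexI[of _ "f + of_nat p * g"] exI[of _ z]) (auto intro!: image_eqI[of _ _ "(f, g)"])
      qed
    qed
  qed
  then show ?thesis using that by metis
qed

section \<open>Integer multiples and almost integral elements\<close>

lemma algebraic_int_poly:
  fixes x :: "'k::field_char_0"
  assumes "algebraic_int x"
  shows "algebraic_int (poly (map_poly of_int q) x)"
  unfolding poly_altdef
  by (intro algebraic_int_sum algebraic_int_mult algebraic_int_power assms) (simp add: coeff_map_poly)

text \<open>Divide an integral equation of \<open>x\<close> by the largest possible power of \<open>x\<close>; the constant term
  is then a nonzero integer that is divisible by \<open>x\<close>.\<close>

lemma algebraic_int_divides_nat:
  fixes x :: "'k::field_char_0"
  assumes x: "algebraic_int x" "x \<noteq> 0"
  obtains n y where "n > 0" "algebraic_int y" "y * x = of_nat n"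
proof -
  obtain p :: "int poly" where p: "poly (map_poly of_int p) x = 0" "lead_coeff p = 1"
    using x(1) unfolding algebraic_int_altdef_ipoly by auto
  have "\<exists>n y. n > 0 \<and> algebraic_int y \<and> y * x = of_nat n"
    using p
  proof (induction p)
    case 0
    then show ?case by simp
  next
    case (pCons c q)
    have q: "of_int c + x * poly (map_poly of_int q) x = 0"
      using pCons.prems(1) by (simp add: Polynomial.map_poly_pCons)
    show ?case
    proof (cases "c = 0")
      case True
      then have "q \<noteq> 0" using pCons.hyps by simp
      then show ?thesis
        using pCons.IH pCons.prems(2) q x(2) True by simp
    next
      case False
      define y where "y = - of_int (sgn c) * poly (map_poly of_int q) x"
      have "y * x = of_int (sgn c * c)"
        using q by (simp add: y_def eq_neg_iff_add_eq_0[symmetric] ac_simps)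
      also have "sgn c * c = int (nat \<bar>c\<bar>)"
        by (simp add: abs_sgn[symmetric] mult.commute)
      finally have "y * x = of_nat (nat \<bar>c\<bar>)" by simp
      moreover have "algebraic_int y"
        unfolding y_def by (intro algebraic_int_mult algebraic_int_minus algebraic_int_poly x) simp
      ultimately show ?thesis using False by (intro exI[of _ "nat \<bar>c\<bar>"] exI[of _ y]) simp
    qed
  qed
  then show ?thesis using that by blast
qed

lemma pigeonhole_residues:
  fixes f :: "nat \<Rightarrow> 'k::field_char_0"
  assumes K: "number_field TYPE('k)" and "n > 0" and f: "\<And>i. algebraic_int (f i)"
  obtains i j where "i < j" "algebraic_int ((f j - f i) / of_nat n)"
proof -
  obtain F :: "'k set" where F: "finite F"
    "\<And>x. algebraic_int x \<Longrightarrow> \<exists>r\<in>F. \<exists>y. algebraic_int y \<and> x = r + of_nat n * y"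
    by (rule finite_residues[OF K \<open>n > 0\<close>]) blast
  have "\<exists>r. r \<in> F \<and> (\<exists>y. algebraic_int y \<and> f i = r + of_nat n * y)" for i
    using F(2)[OF f[of i]] by blast
  then obtain r where r: "\<And>i. r i \<in> F" "\<And>i. \<exists>y. algebraic_int y \<and> f i = r i + of_nat n * y"
    by metis
  have "\<not> inj r"
  proof
    assume "inj r"
    moreover have "finite (range r)"
      by (rule finite_subset[OF _ F(1)]) (use r(1) in blast)
    ultimately show False
      using finite_imageD by blast
  qed
  then obtain i j where "i \<noteq> j" "r i = r j"
    by (auto simp: inj_def)
  then obtain i j where ij: "i < j" "r i = r j"
    by (cases "i < j") (auto dest: sym intro: linorder_neqE_nat)
  obtain y z where y: "algebraic_int y" "f i = r i + of_nat n * y"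
    and z: "algebraic_int z" "f j = r j + of_nat n * z"
    using r(2) by meson
  have "(f j - f i) / of_nat n = z - y"
    using \<open>n > 0\<close> by (simp add: y z ij field_simps)
  then show ?thesis
    using that[OF ij(1)] algebraic_int_diff[OF z(1) y(1)] by simp
qed

text \<open>This is complete integral closedness of \<open>\<O>\<close>. By the pigeonhole principle two of the elements
  \<open>n * \<gamma> ^ k\<close> are congruent modulo \<open>n\<close>, so \<open>\<gamma> ^ j - \<gamma> ^ i\<close> is integral for some \<open>i < j\<close>, and \<open>\<gamma>\<close> satisfies a
  monic equation over \<open>\<O>\<close>.\<close>

lemma almost_integral_imp_algebraic_int:
  fixes \<gamma> :: "'k::field_char_0"
  assumes K: "number_field TYPE('k)" and n: "n > 0"
    and \<gamma>: "\<And>k. algebraic_int (of_nat n * \<gamma> ^ k)"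
  shows "algebraic_int \<gamma>"
proof -
  obtain i j where ij: "i < j"
    "algebraic_int ((of_nat n * \<gamma> ^ j - of_nat n * \<gamma> ^ i) / of_nat n)"
    by (rule pigeonhole_residues[OF K n \<gamma>])
  have eq: "(of_nat n * \<gamma> ^ j - of_nat n * \<gamma> ^ i) / of_nat n = \<gamma> ^ j - \<gamma> ^ i"
    using n by (simp add: field_simps)
  define p :: "'k poly" where "p = Polynomial.monom 1 j + Polynomial.monom (- 1) i"
  have deg: "Polynomial.degree p = j"
    unfolding p_def using ij(1)
    by (subst degree_add_eq_left) (auto simp: Polynomial.degree_monom_eq)
  show ?thesis
  proof (rule algebraic_int_root)
    show "algebraic_int (\<gamma> ^ j - \<gamma> ^ i)" using ij(2) unfolding eq .
    show "poly p \<gamma> = \<gamma> ^ j - \<gamma> ^ i" by (simp add: p_def poly_monom)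
    show "\<forall>i. Polynomial.coeff p i \<in> \<int>" by (simp add: p_def)
    show "lead_coeff p = 1" using ij(1) unfolding deg by (simp add: p_def)
    show "Polynomial.degree p > 0" using ij(1) by (simp add: deg)
  qed
qed

section \<open>Ideals and maximal ideals of the ring of integers\<close>

text \<open>Ideals of \<open>\<O>\<close>, described by conditions on elements of the type \<open>'k\<close>, so that elements of \<open>K\<close>
  outside \<open>\<O>\<close> can be multiplied with elements of ideals without changing the carrier.\<close>

definition integral_ideal :: "'k::field_char_0 set \<Rightarrow> bool"
  where "integral_ideal I \<longleftrightarrow> 0 \<in> I \<and> (\<forall>x\<in>I. algebraic_int x) \<and> (\<forall>x\<in>I. \<forall>y\<in>I. x + y \<in> I) \<and>
    (\<forall>r x. algebraic_int r \<longrightarrow> x \<in> I \<longrightarrow> r * x \<in> I)"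

lemma
  assumes "integral_ideal I"
  shows integral_ideal_zero: "0 \<in> I"
    and integral_ideal_integral: "x \<in> I \<Longrightarrow> algebraic_int x"
    and integral_ideal_add: "x \<in> I \<Longrightarrow> y \<in> I \<Longrightarrow> x + y \<in> I"
    and integral_ideal_mult: "algebraic_int r \<Longrightarrow> x \<in> I \<Longrightarrow> r * x \<in> I"
    and integral_ideal_mult': "algebraic_int r \<Longrightarrow> x \<in> I \<Longrightarrow> x * r \<in> I"
  using assms by (auto simp: integral_ideal_def mult.commute[of x])

lemma integral_ideal_diff:
  assumes "integral_ideal I" "x \<in> I" "y \<in> I"
  shows "x - y \<in> I"
  using integral_ideal_add[OF assms(1,2) integral_ideal_mult[OF assms(1) _ assms(3), of "- 1"]]
  by simp

lemma integral_ideal_contains_nat: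
  assumes I: "integral_ideal I" and "I \<noteq> {0}"
  obtains n where "n > 0" "of_nat n \<in> I"
proof -
  obtain x where x: "x \<in> I" "x \<noteq> 0"
    using assms(2) integral_ideal_zero[OF I] by blast
  obtain n y where "n > 0" "algebraic_int y" "y * x = of_nat n"
    by (rule algebraic_int_divides_nat[OF integral_ideal_integral[OF I x(1)] x(2)])
  then show ?thesis
    using that integral_ideal_mult[OF I _ x(1)] by metis
qed

text \<open>Such an ideal is a union of classes modulo \<open>n\<close>, so it is determined by the
  representatives that it contains.\<close>

lemma finite_integral_ideals_containing_nat:
  assumes K: "number_field TYPE('k::field_char_0)" and "n > 0"
  shows "finite {I :: 'k set. integral_ideal I \<and> of_nat n \<in> I}" (is "finite ?A")
proof -
  obtain F :: "'k set" where F: "finite F"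
    "\<And>x. algebraic_int x \<Longrightarrow> \<exists>r\<in>F. \<exists>y. algebraic_int y \<and> x = r + of_nat n * y"
    by (rule finite_residues[OF K \<open>n > 0\<close>]) blast
  have sub: "I \<subseteq> J" if I: "I \<in> ?A" and J: "J \<in> ?A" and eq: "I \<inter> F = J \<inter> F" for I J
  proof
    fix x assume x: "x \<in> I"
    have "algebraic_int x"
      using I x integral_ideal_integral by blast
    then obtain r y where r: "r \<in> F" "algebraic_int y" "x = r + of_nat n * y"
      using F(2) by blast
    have "of_nat n * y \<in> I" "of_nat n * y \<in> J"
      using I J r(2) by (auto intro: integral_ideal_mult')
    moreover have "r = x - of_nat n * y" using r(3) by simp
    ultimately have "r \<in> I"
      using I x by (auto intro: integral_ideal_diff)
    then have "r \<in> J" using r(1) eq by blast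
    then show "x \<in> J"
      using \<open>of_nat n * y \<in> J\<close> J r(3) by (auto intro: integral_ideal_add)
  qed
  have "inj_on (\<lambda>I. I \<inter> F) ?A"
    by (rule inj_onI) (rule equalityI; rule sub; simp)
  moreover have "finite ((\<lambda>I. I \<inter> F) ` ?A)"
    by (rule finite_subset[of _ "Pow F"]) (use F(1) in auto)
  ultimately show ?thesis by (rule finite_imageD[rotated])
qed

text \<open>Maximality is expressed by its most useful consequence: the residue ring is a field.\<close>

definition max_integral_ideal :: "'k::field_char_0 set \<Rightarrow> bool"
  where "max_integral_ideal P \<longleftrightarrow> integral_ideal P \<and> 1 \<notin> P \<and>
    (\<forall>t. algebraic_int t \<longrightarrow> t \<notin> P \<longrightarrow> (\<exists>y. algebraic_int y \<and> 1 - t * y \<in> P))"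

lemma
  assumes "max_integral_ideal P"
  shows max_integral_ideal_ideal: "integral_ideal P"
    and max_integral_ideal_proper: "1 \<notin> P"
    and max_integral_ideal_inverse:
      "algebraic_int t \<Longrightarrow> t \<notin> P \<Longrightarrow> \<exists>y. algebraic_int y \<and> 1 - t * y \<in> P"
  using assms by (auto simp: max_integral_ideal_def)

lemma max_integral_ideal_prime:
  assumes P: "max_integral_ideal P" and s: "algebraic_int s" "s \<notin> P" and t: "algebraic_int t" "t \<notin> P"
  shows "s * t \<notin> P"
proof
  note I = max_integral_ideal_ideal[OF P]
  assume st: "s * t \<in> P"
  obtain y where y: "algebraic_int y" "1 - s * y \<in> P"
    using max_integral_ideal_inverse[OF P s] by blast
  have "(1 - s * y) * t + y * (s * t) \<in> P"
    by (intro integral_ideal_add[OF I] integral_ideal_mult[OF I] integral_ideal_mult'[OF I] y st t)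
  then have "t \<in> P" by (simp add: algebra_simps)
  then show False using t by simp
qed

lemma max_integral_ideal_not_subset:
  assumes P: "max_integral_ideal P" and Q: "max_integral_ideal Q" and "P \<noteq> Q"
  shows "\<not> P \<subseteq> Q"
proof
  note I = max_integral_ideal_ideal[OF Q]
  assume sub: "P \<subseteq> Q"
  then obtain t where t: "t \<in> Q" "t \<notin> P" using \<open>P \<noteq> Q\<close> by blast
  obtain y where y: "algebraic_int y" "1 - t * y \<in> P"
    using max_integral_ideal_inverse[OF P integral_ideal_integral[OF I t(1)] t(2)] by blast
  have "1 - t * y + t * y \<in> Q"
    using sub y t by (intro integral_ideal_add[OF I] integral_ideal_mult'[OF I]) auto
  then show False using max_integral_ideal_proper[OF Q] by simp
qed

lemma max_integral_ideal_exists: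
  fixes I :: "'k::field_char_0 set"
  assumes K: "number_field TYPE('k)" and I: "integral_ideal I" "I \<noteq> {0}" "1 \<notin> I"
  obtains P where "max_integral_ideal P" "I \<subseteq> P"
proof -
  obtain n where n: "n > 0" "of_nat n \<in> I"
    by (rule integral_ideal_contains_nat[OF I(1,2)])
  define A where "A = {J :: 'k set. integral_ideal J \<and> of_nat n \<in> J \<and> 1 \<notin> J}"
  have "finite A"
    by (rule finite_subset[OF _ finite_integral_ideals_containing_nat[OF K n(1)]]) (auto simp: A_def)
  moreover have "I \<in> A" using I n by (simp add: A_def)
  ultimately obtain P where P: "P \<in> A" "I \<subseteq> P" and max: "\<And>J. J \<in> A \<Longrightarrow> P \<subseteq> J \<Longrightarrow> P = J"
    using finite_has_maximal2[of A I] by auto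
  have PI: "integral_ideal P" and nP: "of_nat n \<in> P" and "1 \<notin> P" using P(1) by (auto simp: A_def)
  have "\<exists>y. algebraic_int y \<and> 1 - t * y \<in> P" if t: "algebraic_int t" "t \<notin> P" for t
  proof -
    define J where "J = {t * y + z | y z. algebraic_int y \<and> z \<in> P}"
    have JI: "t * y + z \<in> J" if "algebraic_int y" "z \<in> P" for y z
      using that by (auto simp: J_def)
    have "integral_ideal J"
      unfolding integral_ideal_def
    proof (intro conjI ballI allI impI)
      show "0 \<in> J" using JI[of 0 0] integral_ideal_zero[OF PI] by simp
      show "algebraic_int x" if "x \<in> J" for x
        using that t by (auto simp: J_def intro!: algebraic_int_add algebraic_int_mult
          intro: integral_ideal_integral[OF PI])
      show "x + y \<in> J" if xy: "x \<in> J" "y \<in> J" for x y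
      proof -
        obtain a b c d where *: "x = t * a + b" "y = t * c + d" "algebraic_int a" "algebraic_int c" "b \<in> P" "d \<in> P"
          using xy by (auto simp: J_def)
        then have eq: "x + y = t * (a + c) + (b + d)" by (simp add: algebra_simps)
        show ?thesis
          unfolding eq by (intro JI algebraic_int_add integral_ideal_add[OF PI] *)
      qed
      show "r * x \<in> J" if r: "algebraic_int r" and x: "x \<in> J" for r x
      proof -
        obtain a b where *: "x = t * a + b" "algebraic_int a" "b \<in> P"
          using x by (auto simp: J_def)
        then have eq: "r * x = t * (r * a) + r * b" by (simp add: algebra_simps)
        show ?thesis
          unfolding eq by (intro JI algebraic_int_mult integral_ideal_mult[OF PI] r *)
      qed
    qed
    moreover have "P \<subseteq> J" using JI[of 0] by auto
    moreover have "t \<in> J" using JI[of 1 0] integral_ideal_zero[OF PI] by simp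
    ultimately have "1 \<in> J"
      using max[of J] t(2) nP unfolding A_def by blast
    then obtain y z where "1 = t * y + z" "algebraic_int y" "z \<in> P"
      by (auto simp: J_def)
    then have "1 - t * y = z" by (metis add_diff_cancel_left')
    then show ?thesis using \<open>algebraic_int y\<close> \<open>z \<in> P\<close> by blast
  qed
  then have "max_integral_ideal P"
    using PI \<open>1 \<notin> P\<close> by (simp add: max_integral_ideal_def)
  then show ?thesis using P(2) by (rule that)
qed

section \<open>Local invertibility of ideals\<close>

text \<open>The idea is to find \<open>b\<close> whose class in the finite ring \<open>\<O>/n\<O>\<close> is nonzero and annihilated by \<open>P\<close>.
  For an induction over generators of \<open>P\<close> the class of \<open>b\<close> is required to be nonzero even in the localization at
  \<open>P\<close>, that is, not to be killed by any \<open>t \<notin> P\<close>. In the localization each \<open>x \<in> P\<close> is nilpotent, because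
  \<open>x ^ i * (1 - x ^ (j - i))\<close> vanishes in \<open>\<O>/n\<O>\<close> for suitable \<open>i < j\<close>. So \<open>b\<close> can be multiplied by
  the last power of \<open>x\<close> that does not kill it.\<close>

lemma max_integral_ideal_annihilator:
  fixes P :: "'k::field_char_0 set"
  assumes K: "number_field TYPE('k)" and P: "max_integral_ideal P"
    and n: "n > 0" "of_nat n \<in> P" and G: "finite G" "G \<subseteq> P"
  shows "\<exists>b. algebraic_int b \<and>
    (\<forall>t. algebraic_int t \<longrightarrow> t \<notin> P \<longrightarrow> \<not> algebraic_int (b * t / of_nat n)) \<and>
    (\<forall>x\<in>G. algebraic_int (b * x / of_nat n))"
  using G
proof (induction G rule: finite_induct)
  note I = max_integral_ideal_ideal[OF P]
  case empty
  have "\<not> algebraic_int (t / of_nat n)" if "t \<notin> P" for t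
    using integral_ideal_mult[OF I _ n(2), of "t / of_nat n"] n(1) that by auto
  then show ?case by (intro exI[of _ 1]) simp
next
  note I = max_integral_ideal_ideal[OF P]
  case (insert x G)
  then obtain b where b: "algebraic_int b" "\<And>x. x \<in> G \<Longrightarrow> algebraic_int (b * x / of_nat n)"
    and reg: "\<And>t. algebraic_int t \<Longrightarrow> t \<notin> P \<Longrightarrow> \<not> algebraic_int (b * t / of_nat n)"
    by auto
  have x: "x \<in> P" "algebraic_int x"
    using insert.prems integral_ideal_integral[OF I] by auto
  \<comment> \<open>A power of \<open>x\<close> kills \<open>b\<close> in the localization if some \<open>s \<notin> P\<close> times this power kills \<open>b\<close>.\<close>
  define kills where "kills k \<longleftrightarrow>
    (\<exists>s. algebraic_int s \<and> s \<notin> P \<and> algebraic_int (b * s * x ^ k / of_nat n))" for k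
  obtain i j where ij: "i < j" "algebraic_int ((x ^ j - x ^ i) / of_nat n)"
    by (rule pigeonhole_residues[OF K n(1), of "\<lambda>i. x ^ i"]) (auto intro: algebraic_int_power x)
  have "kills i"
    unfolding kills_def
  proof (intro exI[of _ "1 - x ^ (j - i)"] conjI)
    show "algebraic_int (1 - x ^ (j - i))"
      by (intro algebraic_int_diff algebraic_int_power x) simp
    have "x ^ (j - i) = x ^ (j - i - 1) * x"
      using ij(1) by (metis power_minus_mult zero_less_diff)
    then have "x ^ (j - i) \<in> P"
      using integral_ideal_mult[OF I algebraic_int_power[OF x(2)] x(1)] by simp
    then show "1 - x ^ (j - i) \<notin> P"
      using integral_ideal_add[OF I, of "1 - x ^ (j - i)" "x ^ (j - i)"] max_integral_ideal_proper[OF P]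
      by auto
    have "x ^ (j - i) * x ^ i = x ^ j"
      using ij(1) by (simp flip: power_add)
    then have "b * (1 - x ^ (j - i)) * x ^ i / of_nat n = - b * ((x ^ j - x ^ i) / of_nat n)"
      by (simp add: algebra_simps diff_divide_distrib)
    then show "algebraic_int (b * (1 - x ^ (j - i)) * x ^ i / of_nat n)"
      using algebraic_int_mult[OF algebraic_int_minus[OF b(1)] ij(2)] by simp
  qed
  define k where "k = (LEAST k. kills k)"
  have "kills k" unfolding k_def using \<open>kills i\<close> by (rule LeastI)
  then obtain s where s: "algebraic_int s" "s \<notin> P" "algebraic_int (b * s * x ^ k / of_nat n)"
    unfolding kills_def by blast
  have "k \<noteq> 0"
  proof
    assume "k = 0"
    then show False using reg[OF s(1,2)] s(3) by simp
  qed
  then obtain l where l: "k = Suc l" by (cases k) auto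
  have min: "\<not> kills l"
    using not_less_Least[of l kills] l unfolding k_def by simp
  show ?case
  proof (intro exI[of _ "b * s * x ^ l"] conjI allI impI ballI)
    show "algebraic_int (b * s * x ^ l)"
      by (intro algebraic_int_mult algebraic_int_power b s x)
    show "\<not> algebraic_int (b * s * x ^ l * t / of_nat n)" if t: "algebraic_int t" "t \<notin> P" for t
    proof
      assume "algebraic_int (b * s * x ^ l * t / of_nat n)"
      then have "algebraic_int (b * (s * t) * x ^ l / of_nat n)"
        by (simp add: ac_simps)
      then have "kills l"
        unfolding kills_def
        using algebraic_int_mult[OF s(1) t(1)] max_integral_ideal_prime[OF P s(1,2) t] by blast
      then show False using min by simp
    qed
    fix y assume "y \<in> insert x G"
    then show "algebraic_int (b * s * x ^ l * y / of_nat n)"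
    proof
      assume "y = x"
      then show ?thesis using s(3) by (simp add: l ac_simps)
    next
      assume "y \<in> G"
      then have "algebraic_int (s * x ^ l * (b * y / of_nat n))"
        by (intro algebraic_int_mult algebraic_int_power s x b)
      then show ?thesis by (simp add: ac_simps)
    qed
  qed
qed

text \<open>Dividing the annihilating element of the previous lemma by \<open>n\<close> gives an element of \<open>P\<inverse>\<close>
  outside \<open>\<O>\<close>.\<close>

lemma max_integral_ideal_nonintegral_multiplier:
  fixes P :: "'k::field_char_0 set"
  assumes K: "number_field TYPE('k)" and P: "max_integral_ideal P" and "P \<noteq> {0}"
  obtains \<gamma> where "\<not> algebraic_int \<gamma>" "\<And>x. x \<in> P \<Longrightarrow> algebraic_int (\<gamma> * x)"
proof -
  note I = max_integral_ideal_ideal[OF P]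
  obtain n where n: "n > 0" "of_nat n \<in> P"
    by (rule integral_ideal_contains_nat[OF I \<open>P \<noteq> {0}\<close>])
  obtain F :: "'k set" where F: "finite F"
    "\<And>x. algebraic_int x \<Longrightarrow> \<exists>r\<in>F. \<exists>y. algebraic_int y \<and> x = r + of_nat n * y"
    by (rule finite_residues[OF K n(1)]) blast
  obtain b where b: "algebraic_int b" "\<And>x. x \<in> F \<inter> P \<Longrightarrow> algebraic_int (b * x / of_nat n)"
    and reg: "\<And>t. algebraic_int t \<Longrightarrow> t \<notin> P \<Longrightarrow> \<not> algebraic_int (b * t / of_nat n)"
    using max_integral_ideal_annihilator[OF K P n, of "F \<inter> P"] F(1) by auto
  show ?thesis
  proof
    show "\<not> algebraic_int (b / of_nat n)"
      using reg[of 1] max_integral_ideal_proper[OF P] by simp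
    fix x assume x: "x \<in> P"
    obtain r y where r: "r \<in> F" "algebraic_int y" "x = r + of_nat n * y"
      using F(2)[OF integral_ideal_integral[OF I x]] by blast
    have "r = x - of_nat n * y" using r(3) by simp
    then have "r \<in> P"
      using integral_ideal_diff[OF I x integral_ideal_mult'[OF I r(2) n(2)]] by simp
    then have "algebraic_int (b * r / of_nat n + b * y)"
      by (intro algebraic_int_add algebraic_int_mult b r) (use r in simp)
    moreover have "b / of_nat n * x = b * r / of_nat n + b * y"
      using n(1) by (simp add: r(3) field_simps)
    ultimately show "algebraic_int (b / of_nat n * x)" by simp
  qed
qed

definition inverse_ideal :: "'k::field_char_0 set \<Rightarrow> 'k set"
  where "inverse_ideal I = {y. \<forall>x\<in>I. algebraic_int (x * y)}"

text \<open>Suppose that \<open>I * I\<inverse>\<close> is contained in \<open>P\<close>, and let \<open>\<gamma>\<close> be a nonintegral element with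
  \<open>\<gamma>P \<subseteq> \<O>\<close>. Then \<open>\<gamma>\<close> maps \<open>I\<inverse>\<close> into itself, so all powers of \<open>\<gamma>\<close> lie in \<open>I\<inverse>\<close>. They have a common
  denominator, which contradicts complete integral closedness.\<close>

lemma integral_ideal_locally_invertible:
  fixes I P :: "'k::field_char_0 set"
  assumes K: "number_field TYPE('k)" and I: "integral_ideal I" "I \<noteq> {0}"
    and P: "max_integral_ideal P" "P \<noteq> {0}"
  shows "\<exists>x\<in>I. \<exists>y\<in>inverse_ideal I. x * y \<notin> P"
proof (rule ccontr)
  assume "\<not> ?thesis"
  then have sub: "x * y \<in> P" if "x \<in> I" "y \<in> inverse_ideal I" for x y
    using that by blast
  obtain \<gamma> where \<gamma>: "\<not> algebraic_int \<gamma>" "\<And>x. x \<in> P \<Longrightarrow> algebraic_int (\<gamma> * x)"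
    by (rule max_integral_ideal_nonintegral_multiplier[OF K P]) blast
  have step: "\<gamma> * y \<in> inverse_ideal I" if "y \<in> inverse_ideal I" for y
    using \<gamma>(2)[OF sub[OF _ that]] by (auto simp: inverse_ideal_def ac_simps)
  have power: "\<gamma> ^ k \<in> inverse_ideal I" for k
  proof (induction k)
    case 0
    then show ?case by (simp add: inverse_ideal_def integral_ideal_integral[OF I(1)])
  next
    case (Suc k)
    then show ?case using step by simp
  qed
  obtain n where n: "n > 0" "of_nat n \<in> I"
    by (rule integral_ideal_contains_nat[OF I])
  have "algebraic_int (of_nat n * \<gamma> ^ k)" for k
    using power[of k] n(2) by (auto simp: inverse_ideal_def)
  then show False
    using almost_integral_imp_algebraic_int[OF K n(1)] \<gamma>(1) by blast
qed

section \<open>Ideals modulo a nonzero ideal\<close>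

lemma max_integral_ideals_separate:
  assumes "finite \<P>" "\<And>P. P \<in> \<P> \<Longrightarrow> max_integral_ideal P" and Q: "max_integral_ideal Q" "Q \<notin> \<P>"
  shows "\<exists>e. algebraic_int e \<and> e \<notin> Q \<and> (\<forall>P\<in>\<P>. e \<in> P)"
  using assms(1,2) Q(2)
proof (induction \<P> rule: finite_induct)
  case empty
  then show ?case
    using max_integral_ideal_proper[OF Q(1)] by (intro exI[of _ 1]) simp
next
  case (insert P \<P>)
  then obtain e where e: "algebraic_int e" "e \<notin> Q" "\<forall>P\<in>\<P>. e \<in> P" by auto
  have P: "max_integral_ideal P" using insert.prems by simp
  obtain t where t: "t \<in> P" "t \<notin> Q"
    using max_integral_ideal_not_subset[OF P Q(1)] insert.prems by auto
  have ta: "algebraic_int t"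
    using integral_ideal_integral[OF max_integral_ideal_ideal[OF P] t(1)] .
  show ?case
  proof (intro exI[of _ "e * t"] conjI ballI)
    show "algebraic_int (e * t)" using e(1) ta by (rule algebraic_int_mult)
    show "e * t \<notin> Q" by (rule max_integral_ideal_prime[OF Q(1) e(1,2) ta t(2)])
    fix P' assume "P' \<in> insert P \<P>"
    then show "e * t \<in> P'"
    proof
      assume "P' = P"
      then show ?thesis
        using integral_ideal_mult[OF max_integral_ideal_ideal[OF P] e(1) t(1)] by simp
    next
      assume P': "P' \<in> \<P>"
      then have "max_integral_ideal P'" using insert.prems by simp
      then show ?thesis
        using integral_ideal_mult'[OF max_integral_ideal_ideal ta] e(3) P' by blast
    qed
  qed
qed

text \<open>If \<open>\<alpha>\<close> works for all \<open>P\<close> in \<open>\<P>\<close> but not for \<open>Q\<close>, add an element of \<open>I\<close> that works for \<open>Q\<close>,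
  multiplied by some \<open>e\<close> that lies in all \<open>P\<close> but not in \<open>Q\<close>.\<close>

lemma integral_ideal_common_local_generator:
  fixes I :: "'k::field_char_0 set"
  assumes K: "number_field TYPE('k)" and I: "integral_ideal I" "I \<noteq> {0}"
    and \<P>: "finite \<P>" "\<And>P. P \<in> \<P> \<Longrightarrow> max_integral_ideal P \<and> P \<noteq> {0}"
  shows "\<exists>\<alpha>\<in>I. \<forall>P\<in>\<P>. \<exists>y\<in>inverse_ideal I. \<alpha> * y \<notin> P"
  using \<P>
proof (induction \<P> rule: finite_induct)
  case empty
  then show ?case using integral_ideal_zero[OF I(1)] by auto
next
  case (insert Q \<P>)
  then obtain \<alpha> where \<alpha>: "\<alpha> \<in> I" "\<And>P. P \<in> \<P> \<Longrightarrow> \<exists>y\<in>inverse_ideal I. \<alpha> * y \<notin> P"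
    by auto
  have max: "max_integral_ideal P" if "P \<in> insert Q \<P>" for P
    using insert.prems that by blast
  show ?case
  proof (cases "\<exists>y\<in>inverse_ideal I. \<alpha> * y \<notin> Q")
    case True
    then show ?thesis using \<alpha> by blast
  next
    case False
    obtain e where e: "algebraic_int e" "e \<notin> Q" "\<forall>P\<in>\<P>. e \<in> P"
      using max_integral_ideals_separate[OF insert.hyps(1) _ max[of Q] insert.hyps(2)] max by blast
    obtain x y where xy: "x \<in> I" "y \<in> inverse_ideal I" "x * y \<notin> Q"
      using integral_ideal_locally_invertible[OF K I] insert.prems by blast
    have alg: "algebraic_int (x * y)" if "y \<in> inverse_ideal I" for y
      using that xy(1) by (auto simp: inverse_ideal_def)
    show ?thesis
    proof (rule bexI[of _ "\<alpha> + e * x"], rule ballI)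
      show "\<alpha> + e * x \<in> I"
        by (intro integral_ideal_add integral_ideal_mult I \<alpha> e xy)
      fix P assume P: "P \<in> insert Q \<P>"
      note PI = max_integral_ideal_ideal[OF max[OF P]]
      show "\<exists>y\<in>inverse_ideal I. (\<alpha> + e * x) * y \<notin> P"
      proof (cases "P = Q")
        case True
        have "e * (x * y) \<notin> P"
          using max_integral_ideal_prime[OF max[OF P] e(1) _ alg[OF xy(2)]] e(2) xy(3) True by simp
        moreover have "\<alpha> * y \<in> P" using False xy(2) True by blast
        moreover have "e * (x * y) = (\<alpha> + e * x) * y - \<alpha> * y"
          by (simp add: algebra_simps)
        ultimately have "(\<alpha> + e * x) * y \<notin> P"
          using integral_ideal_diff[OF PI] by metis
        then show ?thesis using xy(2) by blast
      next
        case False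
        then have "P \<in> \<P>" using P by simp
        then obtain z where z: "z \<in> inverse_ideal I" "\<alpha> * z \<notin> P" using \<alpha>(2) by blast
        have "e * (x * z) \<in> P"
          using integral_ideal_mult'[OF PI alg[OF z(1)]] e(3) \<open>P \<in> \<P>\<close> by blast
        moreover have "\<alpha> * z = (\<alpha> + e * x) * z - e * (x * z)"
          by (simp add: algebra_simps)
        ultimately have "(\<alpha> + e * x) * z \<notin> P"
          using integral_ideal_diff[OF PI] z(2) by metis
        then show ?thesis using z(1) by blast
      qed
    qed
  qed
qed

text \<open>In other words, multiplication by \<open>\<alpha>\<close> is an isomorphism from \<open>\<O>/J\<close> to \<open>I/JI\<close> with inverse induced by
  \<open>\<beta>\<close>. The elements exist because \<open>\<alpha>\<close> can be chosen such that \<open>\<alpha> * I\<inverse> + J\<close> is not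
  contained in any maximal ideal.\<close>

lemma integral_ideal_generator_modulo:
  fixes I J :: "'k::field_char_0 set"
  assumes K: "number_field TYPE('k)" and I: "integral_ideal I" "I \<noteq> {0}" and J: "integral_ideal J" "J \<noteq> {0}"
  obtains \<alpha> \<beta> where "\<alpha> \<in> I" "\<beta> \<in> inverse_ideal I" "1 - \<alpha> * \<beta> \<in> J"
proof -
  obtain n where n: "n > 0" "of_nat n \<in> J"
    by (rule integral_ideal_contains_nat[OF J])
  define \<P> where "\<P> = {P. max_integral_ideal P \<and> J \<subseteq> P}"
  have fin: "finite \<P>"
    by (rule finite_subset[OF _ finite_integral_ideals_containing_nat[OF K n(1)]])
      (use n(2) in \<open>auto simp: \<P>_def max_integral_ideal_ideal\<close>)
  have nonzero: "P \<noteq> {0}" if "J \<subseteq> P" for P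
    using that J integral_ideal_zero[OF J(1)] by blast
  have "\<exists>\<alpha>\<in>I. \<forall>P\<in>\<P>. \<exists>y\<in>inverse_ideal I. \<alpha> * y \<notin> P"
    by (rule integral_ideal_common_local_generator[OF K I fin]) (simp add: \<P>_def nonzero)
  then obtain \<alpha> where \<alpha>: "\<alpha> \<in> I" "\<And>P. P \<in> \<P> \<Longrightarrow> \<exists>y\<in>inverse_ideal I. \<alpha> * y \<notin> P"
    by blast
  define C where "C = {\<alpha> * y + z | y z. y \<in> inverse_ideal I \<and> z \<in> J}"
  have CI: "\<alpha> * y + z \<in> C" if "y \<in> inverse_ideal I" "z \<in> J" for y z
    using that by (auto simp: C_def)
  have zero: "0 \<in> inverse_ideal I" by (simp add: inverse_ideal_def)
  have "integral_ideal C"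
    unfolding integral_ideal_def
  proof (intro conjI ballI allI impI)
    show "0 \<in> C" using CI[OF zero integral_ideal_zero[OF J(1)]] by simp
    show "algebraic_int x" if "x \<in> C" for x
      using that \<alpha>(1) by (auto simp: C_def inverse_ideal_def intro!: algebraic_int_add
        intro: integral_ideal_integral[OF J(1)])
    show "x + y \<in> C" if xy: "x \<in> C" "y \<in> C" for x y
    proof -
      obtain a b c d where *: "x = \<alpha> * a + b" "y = \<alpha> * c + d" "a \<in> inverse_ideal I" "c \<in> inverse_ideal I"
        "b \<in> J" "d \<in> J"
        using xy by (auto simp: C_def)
      have "a + c \<in> inverse_ideal I"
        using *(3,4) by (auto simp: inverse_ideal_def distrib_left intro: algebraic_int_add)
      moreover have eq: "x + y = \<alpha> * (a + c) + (b + d)" by (simp add: * algebra_simps)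
      ultimately show ?thesis
        unfolding eq by (intro CI integral_ideal_add[OF J(1)] *)
    qed
    show "r * x \<in> C" if r: "algebraic_int r" and x: "x \<in> C" for r x
    proof -
      obtain a b where *: "x = \<alpha> * a + b" "a \<in> inverse_ideal I" "b \<in> J"
        using x by (auto simp: C_def)
      have "algebraic_int (r * (x * a))" if "x \<in> I" for x
        using *(2) that by (intro algebraic_int_mult[OF r]) (simp add: inverse_ideal_def)
      then have "r * a \<in> inverse_ideal I"
        by (simp add: inverse_ideal_def ac_simps)
      moreover have eq: "r * x = \<alpha> * (r * a) + r * b" by (simp add: * algebra_simps)
      ultimately show ?thesis
        unfolding eq by (intro CI integral_ideal_mult[OF J(1)] r *)
    qed
  qed
  moreover have JC: "J \<subseteq> C" using CI[OF zero] by auto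
  moreover note nonzero[OF JC]
  moreover have "\<not> C \<subseteq> P" if P: "max_integral_ideal P" for P
  proof
    assume sub: "C \<subseteq> P"
    then have "P \<in> \<P>" using P JC by (auto simp: \<P>_def)
    then obtain y where "y \<in> inverse_ideal I" "\<alpha> * y \<notin> P" using \<alpha>(2) by blast
    then show False using CI[OF _ integral_ideal_zero[OF J(1)], of y] sub by auto
  qed
  ultimately have "1 \<in> C"
    using max_integral_ideal_exists[OF K, of C] by metis
  then obtain \<beta> z where "1 = \<alpha> * \<beta> + z" "\<beta> \<in> inverse_ideal I" "z \<in> J"
    by (auto simp: C_def)
  then have "1 - \<alpha> * \<beta> \<in> J"
    by (metis add_diff_cancel_left')
  then show ?thesis
    using that[OF \<alpha>(1) \<open>\<beta> \<in> inverse_ideal I\<close>] by simp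
qed

section \<open>Characters fixed by the congruence units\<close>

lemma carrier_ring_of_integers: "carrier \<O> = {x. algebraic_int x}"
  by (simp add: ring_of_integers_def)

lemma integral_ideal_ring_of_integers: "integral_ideal (carrier \<O>)"
  by (simp add: integral_ideal_def carrier_ring_of_integers algebraic_int_add algebraic_int_mult)

lemma integral_ideal_if_fractional:
  assumes "fractional_ideal I" "I \<subseteq> carrier \<O>"
  shows "integral_ideal I"
proof -
  have "additive_subgroup I \<K>" and mult: "\<forall>r\<in>carrier \<O>. \<forall>x\<in>I. r * x \<in> I"
    using assms(1) by (auto simp: fractional_ideal_def)
  then interpret additive_subgroup I \<K> by blast
  show ?thesis
    unfolding integral_ideal_def
    using assms(2) mult zero_closed a_closed
    by (auto simp: carrier_ring_of_integers ring_of_type_algebra_def)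
qed

lemma inverse_unit_integral:
  fixes u :: "'k::field_char_0"
  assumes "u \<in> Units \<O>"
  shows "algebraic_int (inverse u)" "u \<noteq> 0"
proof -
  obtain v where "algebraic_int v" "v * u = 1"
    using assms by (auto simp: Units_def ring_of_integers_def ring_of_type_algebra_def)
  then show "u \<noteq> 0" by auto
  then have "v = inverse u"
    using \<open>v * u = 1\<close> by (simp add: field_simps)
  then show "algebraic_int (inverse u)" using \<open>algebraic_int v\<close> by simp
qed

text \<open>This excludes the possibility that the congruence units differ from \<open>{1}\<close> by being empty.\<close>

lemma one_in_congruence_units:
  fixes m_inf :: "('k::field_char_0 \<Rightarrow> real) \<Rightarrow> nat"
  assumes "subgroup \<Gamma> (modulus_units m_inf m0)"
  shows "1 \<in> congruence_units m_inf m0 \<Gamma>"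
proof -
  have pos: "w 1 > 0" if "w \<in> infinite_part m_inf" for w :: "'k \<Rightarrow> real"
    using that ring_hom_one[of w "\<K>" ring_of_type_algebra]
    by (simp add: infinite_part_def real_embeddings_def ring_of_type_algebra_def)
  have "(\<lambda>w\<in>infinite_part m_inf. if w 1 > 0 then 1 else -1 :: int) = (\<lambda>w\<in>infinite_part m_inf. 1)"
    by (rule restrict_ext) (simp only: pos if_True)
  then have "modulus_class m_inf m0 1 = \<one>\<^bsub>modulus_units m_inf m0\<^esub>"
    by (simp add: modulus_class_def modulus_units_def units_of_one FactRing_def sign_img_def
      ring_of_integers_def ring_of_type_algebra_def)
  moreover have "1 \<in> Units \<O>"
    by (auto simp: Units_def ring_of_integers_def ring_of_type_algebra_def)
  ultimately show ?thesis
    using subgroup.one_closed[OF assms] by (simp add: congruence_units_def)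
qed

lemma fixed_characters_iff:
  "\<chi> \<in> fixed_characters m_inf m0 \<Gamma> A \<longleftrightarrow>
    \<chi> \<in> extensional A \<and> (\<forall>x\<in>A. cmod (\<chi> x) = 1) \<and> (\<forall>x\<in>A. \<forall>y\<in>A. \<chi> (x + y) = \<chi> x * \<chi> y) \<and>
    (\<forall>u\<in>congruence_units m_inf m0 \<Gamma>. \<forall>x\<in>A. \<chi> (inverse u * x) = \<chi> x)"
proof -
  have "dual_action A u \<chi> = \<chi> \<longleftrightarrow> (\<forall>x\<in>A. \<chi> (inverse u * x) = \<chi> x)"
    if "\<chi> \<in> extensional A" for u
    using that by (auto simp: dual_action_def fun_eq_iff extensional_def restrict_def)
  then show ?thesis
    by (auto simp: fixed_characters_def pontryagin_dual_def hom_def circle_group_def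
      ring_of_type_algebra_def Pi_iff)
qed

lemma fixed_character_zero:
  assumes "integral_ideal A" "\<chi> \<in> fixed_characters m_inf m0 \<Gamma> A"
  shows "\<chi> 0 = 1"
proof -
  have "\<chi> (0 + 0) = \<chi> 0 * \<chi> 0" "cmod (\<chi> 0) = 1"
    using assms integral_ideal_zero[OF assms(1)] unfolding fixed_characters_iff by blast+
  then show ?thesis by auto
qed

text \<open>Multiplication by \<open>c\<close> commutes with the action of the units, so it pulls fixed characters
  back to fixed characters.\<close>

lemma fixed_characters_pullback:
  fixes A B :: "'k::field_char_0 set"
  assumes B: "integral_ideal B" and c: "\<And>x. x \<in> B \<Longrightarrow> c * x \<in> A"
    and \<chi>: "\<chi> \<in> fixed_characters m_inf m0 \<Gamma> A"
  shows "(\<lambda>x\<in>B. \<chi> (c * x)) \<in> fixed_characters m_inf m0 \<Gamma> B"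
proof -
  have "inverse u * x \<in> B" if "u \<in> congruence_units m_inf m0 \<Gamma>" "x \<in> B" for u x
    using that inverse_unit_integral(1)
    by (auto simp: congruence_units_def intro: integral_ideal_mult[OF B])
  then show ?thesis
    using \<chi> c integral_ideal_add[OF B] unfolding fixed_characters_iff
    by (simp add: distrib_left mult.left_commute[of c])
qed

text \<open>The elements of \<open>\<O>\<close> that map \<open>A\<close> into the common kernel of the fixed characters. This ideal takes the
  place of the ideal \<open>J\<close> generated by the elements \<open>u\<inverse> - 1\<close>: it contains them, so it is
  nonzero if some \<open>u \<noteq> 1\<close> exists, and its definition involves no sums of products.\<close>

definition character_annihilator ::
    "(('k::field_char_0 \<Rightarrow> real) \<Rightarrow> nat) \<Rightarrow> 'k set \<Rightarrow> ((('k \<Rightarrow> real) \<Rightarrow> int) \<times> 'k set) set \<Rightarrow>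
      'k set \<Rightarrow> 'k set"
  where "character_annihilator m_inf m0 \<Gamma> A =
    {z. algebraic_int z \<and> (\<forall>\<chi>\<in>fixed_characters m_inf m0 \<Gamma> A. \<forall>x\<in>A. \<chi> (z * x) = 1)}"

lemma character_annihilatorD:
  assumes "z \<in> character_annihilator m_inf m0 \<Gamma> A"
  shows "algebraic_int z"
    and "\<chi> \<in> fixed_characters m_inf m0 \<Gamma> A \<Longrightarrow> x \<in> A \<Longrightarrow> \<chi> (z * x) = 1"
  using assms unfolding character_annihilator_def by blast+

lemma integral_ideal_character_annihilator:
  assumes A: "integral_ideal A"
  shows "integral_ideal (character_annihilator m_inf m0 \<Gamma> A)"
  unfolding integral_ideal_def
proof (intro conjI ballI allI impI)
  let ?J = "character_annihilator m_inf m0 \<Gamma> A"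
  show "0 \<in> ?J"
    by (simp add: character_annihilator_def fixed_character_zero[OF A])
  show "algebraic_int z" if "z \<in> ?J" for z
    using that by (simp add: character_annihilator_def)
  show "z + w \<in> ?J" if z: "z \<in> ?J" and w: "w \<in> ?J" for z w
  proof -
    have "\<chi> ((z + w) * x) = 1" if \<chi>: "\<chi> \<in> fixed_characters m_inf m0 \<Gamma> A" and x: "x \<in> A" for \<chi> x
    proof -
      have "z * x \<in> A" "w * x \<in> A"
        using z w x by (auto simp: character_annihilator_def intro: integral_ideal_mult[OF A])
      then have "\<chi> (z * x + w * x) = \<chi> (z * x) * \<chi> (w * x)"
        using \<chi> unfolding fixed_characters_iff by blast
      also have "\<dots> = 1"
        using character_annihilatorD(2)[OF z \<chi> x] character_annihilatorD(2)[OF w \<chi> x] by simp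
      finally show ?thesis by (simp add: distrib_right)
    qed
    then show ?thesis
      using z w by (simp add: character_annihilator_def algebraic_int_add)
  qed
  show "r * z \<in> ?J" if r: "algebraic_int r" and z: "z \<in> ?J" for r z
  proof -
    have "\<chi> (r * z * x) = 1" if "\<chi> \<in> fixed_characters m_inf m0 \<Gamma> A" "x \<in> A" for \<chi> x
    proof -
      have "\<chi> (z * (r * x)) = 1"
        using character_annihilatorD(2)[OF z that(1) integral_ideal_mult[OF A r that(2)]] .
      then show ?thesis by (simp add: ac_simps)
    qed
    then show ?thesis
      using z r by (simp add: character_annihilator_def algebraic_int_mult)
  qed
qed

lemma unit_minus_one_in_character_annihilator:
  fixes A :: "'k::field_char_0 set"
  assumes A: "integral_ideal A" and u: "u \<in> congruence_units m_inf m0 \<Gamma>"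
  shows "inverse u - 1 \<in> character_annihilator m_inf m0 \<Gamma> A"
proof -
  have alg: "algebraic_int (inverse u)"
    using u by (auto simp: congruence_units_def inverse_unit_integral)
  have "\<chi> ((inverse u - 1) * x) = 1" if \<chi>: "\<chi> \<in> fixed_characters m_inf m0 \<Gamma> A" and x: "x \<in> A" for \<chi> x
  proof -
    have "(inverse u - 1) * x \<in> A"
      by (intro integral_ideal_mult[OF A] algebraic_int_diff alg x) simp
    then have "\<chi> ((inverse u - 1) * x + x) = \<chi> ((inverse u - 1) * x) * \<chi> x"
      using \<chi> x unfolding fixed_characters_iff by blast
    moreover have "\<chi> (inverse u * x) = \<chi> x" "cmod (\<chi> x) = 1"
      using \<chi> x u unfolding fixed_characters_iff by blast+
    ultimately show ?thesis
      by (auto simp: algebra_simps)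
  qed
  then show ?thesis
    using algebraic_int_diff[OF alg] by (simp add: character_annihilator_def)
qed

lemma fixed_character_mult_cong_one:
  fixes A :: "'k::field_char_0 set"
  assumes A: "integral_ideal A" and \<chi>: "\<chi> \<in> fixed_characters m_inf m0 \<Gamma> A"
    and c: "1 - c \<in> character_annihilator m_inf m0 \<Gamma> A" and x: "x \<in> A"
  shows "\<chi> (c * x) = \<chi> x"
proof -
  have alg: "algebraic_int (1 - c)"
    using c by (simp add: character_annihilator_def)
  then have "algebraic_int c"
    using algebraic_int_diff[OF algebraic_int_1 alg] by simp
  then have "c * x \<in> A" "(1 - c) * x \<in> A"
    using integral_ideal_mult[OF A _ x] alg by blast+
  then have "\<chi> (c * x + (1 - c) * x) = \<chi> (c * x) * \<chi> ((1 - c) * x)"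
    using \<chi> unfolding fixed_characters_iff by blast
  moreover have "\<chi> ((1 - c) * x) = 1"
    by (rule character_annihilatorD(2)[OF c \<chi> x])
  ultimately show ?thesis by (simp add: algebra_simps)
qed

text \<open>A fixed character is trivial on \<open>n * \<O>\<close> for some \<open>n > 0\<close>. Hence its values are \<open>n\<close>-th roots of
  unity, and it is determined by its values on finitely many representatives modulo \<open>n\<close>.\<close>

lemma finite_fixed_characters:
  fixes m_inf :: "('k::field_char_0 \<Rightarrow> real) \<Rightarrow> nat"
  assumes K: "number_field TYPE('k)"
    and J: "character_annihilator m_inf m0 \<Gamma> (carrier \<O>) \<noteq> {0}"
  shows "finite (fixed_characters m_inf m0 \<Gamma> (carrier \<O>))"
proof -
  let ?X = "fixed_characters m_inf m0 \<Gamma> (carrier \<O>)"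
  note R = integral_ideal_ring_of_integers
  obtain n where n: "n > 0" "of_nat n \<in> character_annihilator m_inf m0 \<Gamma> (carrier \<O>)"
    by (rule integral_ideal_contains_nat[OF integral_ideal_character_annihilator[OF R] J])
  obtain F :: "'k set" where F: "finite F" "\<And>r. r \<in> F \<Longrightarrow> algebraic_int r"
    "\<And>x. algebraic_int x \<Longrightarrow> \<exists>r\<in>F. \<exists>y. algebraic_int y \<and> x = r + of_nat n * y"
    by (rule finite_residues[OF K n(1)]) blast
  have add: "\<chi> (x + y) = \<chi> x * \<chi> y" if "\<chi> \<in> ?X" "algebraic_int x" "algebraic_int y" for \<chi> x y
    using that unfolding fixed_characters_iff carrier_ring_of_integers by blast
  have one: "\<chi> (of_nat n * x) = 1" if "\<chi> \<in> ?X" "algebraic_int x" for \<chi> x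
    using character_annihilatorD(2)[OF n(2) that(1)] that(2) by (simp add: carrier_ring_of_integers)
  have root: "\<chi> x ^ n = 1" if \<chi>: "\<chi> \<in> ?X" and x: "algebraic_int x" for \<chi> x
  proof -
    have "\<chi> (of_nat k * x) = \<chi> x ^ k" for k
    proof (induction k)
      case 0
      then show ?case by (simp add: fixed_character_zero[OF R \<chi>])
    next
      case (Suc k)
      have "\<chi> (x + of_nat k * x) = \<chi> x * \<chi> (of_nat k * x)"
        by (intro add \<chi> x algebraic_int_mult) simp
      then show ?case using Suc by (simp add: algebra_simps)
    qed
    then show ?thesis using one[OF \<chi> x] by simp
  qed
  have "inj_on (\<lambda>\<chi>. restrict \<chi> F) ?X"
  proof (rule inj_onI)
    fix \<chi> \<psi> assume \<chi>: "\<chi> \<in> ?X" and \<psi>: "\<psi> \<in> ?X" and eq: "restrict \<chi> F = restrict \<psi> F"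
    show "\<chi> = \<psi>"
    proof (rule extensionalityI[of _ "carrier \<O>"])
      show "\<chi> \<in> extensional (carrier \<O>)" "\<psi> \<in> extensional (carrier \<O>)"
        using \<chi> \<psi> by (auto simp: fixed_characters_iff)
      fix x :: 'k assume "x \<in> carrier \<O>"
      then obtain r y where r: "r \<in> F" "algebraic_int y" "x = r + of_nat n * y"
        using F(3)[of x] by (auto simp: carrier_ring_of_integers)
      have "\<chi> r = \<psi> r" using fun_cong[OF eq, of r] r(1) by simp
      moreover have "\<phi> x = \<phi> r" if "\<phi> \<in> ?X" for \<phi>
        using add[OF that F(2)[OF r(1)] algebraic_int_mult[OF algebraic_int_of_nat r(2)], of n]
          one[OF that r(2)] by (simp add: r(3))
      ultimately show "\<chi> x = \<psi> x" using \<chi> \<psi> by metis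
    qed
  qed
  moreover have "finite ((\<lambda>\<chi>. restrict \<chi> F) ` ?X)"
  proof (rule finite_subset)
    show "(\<lambda>\<chi>. restrict \<chi> F) ` ?X \<subseteq> F \<rightarrow>\<^sub>E {z. z ^ n = 1}"
      using root F(2) by auto
    show "finite (F \<rightarrow>\<^sub>E {z :: complex. z ^ n = 1})"
      using n(1) F(1) by (intro finite_PiE finite_roots_unity) auto
  qed
  ultimately show ?thesis by (rule finite_imageD[rotated])
qed

text \<open>The ideal \<open>J\<close> in the proof annihilates the fixed characters of both \<open>A\<close> and \<open>\<O>\<close>, so that
  multiplication by \<open>\<alpha> * \<beta>\<close> changes neither.\<close>

lemma fixed_characters_eqpoll:
  fixes A :: "'k::field_char_0 set"
  assumes K: "number_field TYPE('k)" and A: "integral_ideal A" "A \<noteq> {0}"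
    and u: "u \<in> congruence_units m_inf m0 \<Gamma>" "u \<noteq> 1"
  shows "fixed_characters m_inf m0 \<Gamma> A \<approx> fixed_characters m_inf m0 \<Gamma> (carrier \<O>)"
proof -
  note R = integral_ideal_ring_of_integers
  define J where "J = character_annihilator m_inf m0 \<Gamma> A \<inter> character_annihilator m_inf m0 \<Gamma> (carrier \<O>)"
  have "integral_ideal J"
    using integral_ideal_character_annihilator[OF A(1), of m_inf m0 \<Gamma>]
      integral_ideal_character_annihilator[OF R, of m_inf m0 \<Gamma>]
    by (simp add: J_def integral_ideal_def)
  moreover have "inverse u - 1 \<in> J"
    unfolding J_def using unit_minus_one_in_character_annihilator A(1) R u(1) by blast
  then have "J \<noteq> {0}"
    using u(2) by auto
  ultimately obtain \<alpha> \<beta> where \<alpha>: "\<alpha> \<in> A" and \<beta>: "\<beta> \<in> inverse_ideal A" and J: "1 - \<alpha> * \<beta> \<in> J"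
    using integral_ideal_generator_modulo[OF K A] by metis
  have \<alpha>R: "\<alpha> * r \<in> A" if "r \<in> carrier \<O>" for r
    using that \<alpha> by (simp add: carrier_ring_of_integers integral_ideal_mult'[OF A(1)])
  have \<beta>A: "\<beta> * x \<in> carrier \<O>" if "x \<in> A" for x
    using that \<beta> by (simp add: carrier_ring_of_integers inverse_ideal_def mult.commute[of \<beta>])
  have "bij_betw (\<lambda>\<chi>. \<lambda>r\<in>carrier \<O>. \<chi> (\<alpha> * r))
    (fixed_characters m_inf m0 \<Gamma> A) (fixed_characters m_inf m0 \<Gamma> (carrier \<O>))"
  proof (rule bij_betw_byWitness[where f' = "\<lambda>\<psi>. \<lambda>x\<in>A. \<psi> (\<beta> * x)"]; (intro ballI)?)
    fix \<chi> assume \<chi>: "\<chi> \<in> fixed_characters m_inf m0 \<Gamma> A"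
    have "\<chi> (\<alpha> * \<beta> * x) = \<chi> x" if "x \<in> A" for x
      using fixed_character_mult_cong_one[OF A(1) \<chi> _ that] J by (simp add: J_def)
    moreover have "\<chi> \<in> extensional A" using \<chi> by (simp add: fixed_characters_iff)
    ultimately show "(\<lambda>x\<in>A. (\<lambda>r\<in>carrier \<O>. \<chi> (\<alpha> * r)) (\<beta> * x)) = \<chi>"
      using \<beta>A by (intro extensionalityI[of _ A]) (auto simp: mult.assoc)
  next
    fix \<psi> assume \<psi>: "\<psi> \<in> fixed_characters m_inf m0 \<Gamma> (carrier \<O>)"
    have "\<psi> (\<alpha> * \<beta> * r) = \<psi> r" if "r \<in> carrier \<O>" for r
      using fixed_character_mult_cong_one[OF R \<psi> _ that] J by (simp add: J_def)
    moreover have "\<psi> \<in> extensional (carrier \<O>)" using \<psi> by (simp add: fixed_characters_iff)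
    ultimately show "(\<lambda>r\<in>carrier \<O>. (\<lambda>x\<in>A. \<psi> (\<beta> * x)) (\<alpha> * r)) = \<psi>"
      using \<alpha>R by (intro extensionalityI[of _ "carrier \<O>"]) (auto simp: ac_simps)
  next
    show "(\<lambda>\<chi>. \<lambda>r\<in>carrier \<O>. \<chi> (\<alpha> * r)) ` fixed_characters m_inf m0 \<Gamma> A
        \<subseteq> fixed_characters m_inf m0 \<Gamma> (carrier \<O>)"
      using fixed_characters_pullback[OF R \<alpha>R] by blast
    show "(\<lambda>\<psi>. \<lambda>x\<in>A. \<psi> (\<beta> * x)) ` fixed_characters m_inf m0 \<Gamma> (carrier \<O>)
        \<subseteq> fixed_characters m_inf m0 \<Gamma> A"
      using fixed_characters_pullback[OF A(1) \<beta>A] by blast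
  qed
  then show ?thesis unfolding eqpoll_def by blast
qed

theorem proposition7p2:
  fixes m_inf :: "('k::field_char_0 \<Rightarrow> real) \<Rightarrow> nat"
    and m0 :: "'k set"
    and \<Gamma> :: "((('k \<Rightarrow> real) \<Rightarrow> int) \<times> 'k set) set"
  assumes "number_field TYPE('k)"
    and "is_modulus m_inf m0"
    and "subgroup \<Gamma> (modulus_units m_inf m0)"
    and "congruence_units m_inf m0 \<Gamma> \<noteq> {1}"
  shows "finite (fixed_characters m_inf m0 \<Gamma> (carrier \<O>)) \<and>
    (\<forall>\<aa>\<in>coprime_fractional_ideals m0. \<aa> \<subseteq> carrier \<O> \<longrightarrow>
      fixed_characters m_inf m0 \<Gamma> \<aa> \<approx> fixed_characters m_inf m0 \<Gamma> (carrier \<O>))"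
proof -
  obtain u where u: "u \<in> congruence_units m_inf m0 \<Gamma>" "u \<noteq> 1"
    using one_in_congruence_units[OF assms(3)] assms(4) by blast
  have "inverse u - 1 \<in> character_annihilator m_inf m0 \<Gamma> (carrier \<O>)"
    by (rule unit_minus_one_in_character_annihilator[OF integral_ideal_ring_of_integers u(1)])
  then have "character_annihilator m_inf m0 \<Gamma> (carrier \<O>) \<noteq> {0}"
    using u(2) by auto
  then have "finite (fixed_characters m_inf m0 \<Gamma> (carrier \<O>))"
    by (rule finite_fixed_characters[OF assms(1)])
  moreover have "fixed_characters m_inf m0 \<Gamma> \<aa> \<approx> fixed_characters m_inf m0 \<Gamma> (carrier \<O>)"
    if "\<aa> \<in> coprime_fractional_ideals m0" "\<aa> \<subseteq> carrier \<O>" for \<aa>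
  proof (rule fixed_characters_eqpoll[OF assms(1) _ _ u])
    have "fractional_ideal \<aa>" using that(1) by (simp add: coprime_fractional_ideals_def)
    then show "integral_ideal \<aa>" "\<aa> \<noteq> {0}"
      using integral_ideal_if_fractional that(2) by (auto simp: fractional_ideal_def)
  qed
  ultimately show ?thesis by blast
qed

end
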